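(* Let $n\ge5$ and $w>n-1$ be integers. Then $([n-1]\setminus\{2\})\cup\{w\}$ is tight if and only if $(n,w)\in\{(5,7),\,(6,9)\}$; and $([n-1]\setminus\{3\})\cup\{w\}$ is never tight.
   Context: $\lVert x\rVert$ denotes the distance from the real number $x$ to the nearest integer, and $[n-1]=\{1,\dots,n-1\}$. For a set $V$ of $n-1$ distinct positive integers, $\mathrm{LR}(V)=\max_{t\in[0,1)}\min_{v\in V}\lVert vt\rVert$, and $V$ is called tight if $\mathrm{LR}(V)=\frac1n$. *)

theory Defs
  imports "HOL-Analysis.Analysis"
begin

definition dist_nearest_int :: "real \<Rightarrow> real" where
  "dist_nearest_int x = \<bar>x - of_int (round x)\<bar>"

definition min_dist :: "nat set \<Rightarrow> real \<Rightarrow> real" where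
  "min_dist V t = Min ((\<lambda>v. dist_nearest_int (real v * t)) ` V)"

text \<open>\<open>Max\<close> is only meaningful on finite sets, so the maximum over \<open>t\<close> is written as a supremum;
  lemma \<open>LR_attained\<close> below shows that it is a maximum.  \<open>LR\<close> and \<open>tight\<close> are meant for
  finite nonempty sets of positive integers.\<close>

definition LR :: "nat set \<Rightarrow> real" where
  "LR V = (SUP t\<in>{0..<1}. min_dist V t)"

text \<open>The \<open>n\<close> in \<open>LR(V) = 1/n\<close> is determined by \<open>V\<close> having \<open>n - 1\<close> elements.\<close>

definition tight :: "nat set \<Rightarrow> bool" where
  "tight V \<longleftrightarrow> LR V = 1 / real (card V + 1)"

lemma dist_nearest_int_lipschitz: "dist_nearest_int x \<le> dist_nearest_int y + \<bar>x - y\<bar>"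
proof -
  have "dist_nearest_int x \<le> \<bar>x - of_int (round y)\<bar>"
    using round_diff_minimal[of x "round y"] by (simp add: dist_nearest_int_def)
  then show ?thesis
    unfolding dist_nearest_int_def by linarith
qed

lemma continuous_on_dist_nearest_int: "continuous_on UNIV dist_nearest_int"
proof -
  have "dist (dist_nearest_int x) (dist_nearest_int y) \<le> dist x y" for x y
    using dist_nearest_int_lipschitz[of x y] dist_nearest_int_lipschitz[of y x]
    by (simp add: dist_real_def abs_minus_commute)
  then show ?thesis
    unfolding continuous_on_iff by (meson le_less_trans)
qed

lemma continuous_on_min_dist:
  assumes "finite V" "V \<noteq> {}"
  shows "continuous_on UNIV (min_dist V)"
proof -
  have c: "continuous_on UNIV (\<lambda>t. dist_nearest_int (real v * t))" for v
    by (rule continuous_on_compose2[OF continuous_on_dist_nearest_int]) (auto intro!: continuous_intros)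
  from assms show ?thesis
    unfolding min_dist_def[abs_def]
  proof (induction V rule: finite_ne_induct)
    case (singleton v)
    then show ?case using c by simp
  next
    case (insert v V)
    then have "continuous_on UNIV (\<lambda>t. min (dist_nearest_int (real v * t))
        (Min ((\<lambda>v. dist_nearest_int (real v * t)) ` V)))"
      by (intro continuous_on_min c)
    then show ?case using insert by simp
  qed
qed

lemma LR_attained:
  assumes "finite V" "V \<noteq> {}"
  shows "\<exists>t\<in>{0..<1}. min_dist V t = LR V \<and> (\<forall>s\<in>{0..<1}. min_dist V s \<le> min_dist V t)"
proof -
  have "\<exists>t\<in>{0..1}. \<forall>s\<in>{0..1}. min_dist V s \<le> min_dist V t"
    by (rule continuous_attains_sup)
       (auto intro: continuous_on_subset[OF continuous_on_min_dist[OF assms]])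
  then obtain t where t: "t \<in> {0..1}" "\<And>s. s \<in> {0..1} \<Longrightarrow> min_dist V s \<le> min_dist V t"
    by blast
  have "min_dist V 0 = min_dist V 1"
    by (simp add: min_dist_def dist_nearest_int_def)
  then obtain u where u: "u \<in> {0..<1}" "\<And>s. s \<in> {0..<1} \<Longrightarrow> min_dist V s \<le> min_dist V u"
  proof (cases "t = 1")
    case True
    with t \<open>min_dist V 0 = min_dist V 1\<close> show ?thesis by (intro that[of 0]) auto
  next
    case False
    with t show ?thesis by (intro that[of t]) auto
  qed
  have "LR V = min_dist V u"
    unfolding LR_def using u by (intro cSup_eq_maximum) auto
  with u show ?thesis by auto
qed

end

theory Submission
  imports Defs
begin

text \<open>
  If all of \<open>[n - 1] \<setminus> {2}\<close> stays at distance more than \<open>1/n\<close> from the integers at time \<open>t\<close>, then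
  by Dirichlet's theorem \<open>t\<close> lies near \<open>1/2\<close>; writing \<open>t = 1/2 - s\<close>, the admissible \<open>s\<close> form an
  interval starting at \<open>1/(4n)\<close>. The speed \<open>w\<close> stretches this interval by the factor \<open>w\<close>, and it
  is harmless unless the stretched interval falls inside a single bad interval of length \<open>2/n\<close>.
  A long interval cannot, and for smaller \<open>w\<close> the left end point is already good; only finitely many
  pairs \<open>(n, w)\<close> are left over. For \<open>3\<close> one argues in the same way near \<open>1/3\<close>, where for \<open>w\<close> not
  divisible by \<open>3\<close> one of the two times \<open>1/3 \<plusminus> s\<close> is always good.
\<close>

section \<open>Points far from the integers, and bounds on \<open>LR\<close>\<close>

lemma dist_nearest_int_gtI:
  assumes "of_int k + d < x" "x < of_int k + 1 - d"
  shows "d < dist_nearest_int x"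
proof (cases "round x \<le> k")
  case True
  then have "real_of_int (round x) \<le> of_int k" by simp
  with assms show ?thesis unfolding dist_nearest_int_def by linarith
next
  case False
  then have "real_of_int k + 1 \<le> of_int (round x)" by linarith
  with assms show ?thesis unfolding dist_nearest_int_def by linarith
qed

lemma dist_nearest_int_gtD:
  assumes "d < dist_nearest_int x"
  shows "\<exists>k. of_int k + d < x \<and> x < of_int k + 1 - d"
proof -
  have "dist_nearest_int x \<le> \<bar>x - of_int m\<bar>" for m
    using round_diff_minimal[of x m] by (simp add: dist_nearest_int_def)
  from this[of "\<lfloor>x\<rfloor>"] this[of "\<lfloor>x\<rfloor> + 1"] assms
  have "of_int \<lfloor>x\<rfloor> + d < x \<and> x < of_int \<lfloor>x\<rfloor> + 1 - d"
    by simp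
  then show ?thesis by blast
qed

lemma LR_gt:
  assumes "finite V" "V \<noteq> {}" "0 \<le> t" "t < 1"
    and "\<And>v. v \<in> V \<Longrightarrow> d < dist_nearest_int (real v * t)"
  shows "d < LR V"
proof -
  have "d < min_dist V t"
    using assms by (simp add: min_dist_def)
  also have "\<dots> \<le> LR V"
    using LR_attained[OF assms(1,2)] assms(3,4) by auto
  finally show ?thesis .
qed

lemma LR_eqI:
  assumes "finite V" "V \<noteq> {}" "0 \<le> t" "t < 1"
    and lower: "\<And>v. v \<in> V \<Longrightarrow> d \<le> dist_nearest_int (real v * t)"
    and upper: "\<And>s. 0 \<le> s \<Longrightarrow> s < 1 \<Longrightarrow> \<exists>v\<in>V. dist_nearest_int (real v * s) \<le> d"
  shows "LR V = d"
proof (rule antisym)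
  have "d \<le> min_dist V t"
    using assms by (simp add: min_dist_def)
  also have "\<dots> \<le> LR V"
    using LR_attained[OF assms(1,2)] assms(3,4) by auto
  finally show "d \<le> LR V" .
  obtain s where s: "0 \<le> s" "s < 1" "min_dist V s = LR V"
    using LR_attained[OF assms(1,2)] by auto
  obtain v where "v \<in> V" "dist_nearest_int (real v * s) \<le> d"
    using upper[OF s(1,2)] by blast
  with assms(1,2) have "min_dist V s \<le> d"
    unfolding min_dist_def by (subst Min_le_iff) auto
  with s show "LR V \<le> d" by simp
qed

text \<open>The points within \<open>d\<close> of the integers form bad gaps of length
  \<open>2 * d\<close>. If \<open>a - h\<close> is outside them or at a right end, points just right
  of \<open>a\<close> work; otherwise an interval longer than \<open>2 * d\<close> runs past the
  right end of its gap. The shift \<open>h\<close> will absorb the fractional part of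
  \<open>w / 2\<close>.\<close>

lemma interval_contains_far_point:
  fixes a b h d :: real
  assumes "a < b" "d < 1/2"
    and "2 * d < b - a \<or> (\<exists>k::int. of_int k + d \<le> a - h \<and> a - h < of_int k + 1 - d)"
  shows "\<exists>x (k::int). a < x \<and> x < b \<and> of_int k + d < x - h \<and> x - h < of_int k + 1 - d"
proof -
  \<comment> \<open>This puts \<open>a - h\<close> into \<open>[k + d, k + 1 + d)\<close>: a good
    stretch followed by the bad gap around \<open>k + 1\<close>.\<close>
  define k where "k = \<lfloor>a - h - d\<rfloor>"
  have k: "of_int k + d \<le> a - h" "a - h < of_int k + 1 + d"
    unfolding k_def by linarith+
  show ?thesis
  proof (cases "\<exists>k::int. of_int k + d \<le> a - h \<and> a - h < of_int k + 1 - d")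
    case True
    then obtain m :: int where m: "of_int m + d \<le> a - h" "a - h < of_int m + 1 - d" by blast
    obtain x where "a < x" "x < min b (h + of_int m + 1 - d)"
      using dense[of a "min b (h + of_int m + 1 - d)"] assms m by (auto simp: algebra_simps)
    with m show ?thesis by (intro exI[of _ x] exI[of _ m]) auto
  next
    case False
    with k have "of_int k + 1 - d \<le> a - h" by force
    with False assms have "h + of_int k + 1 + d < b" by auto
    then obtain x where "h + of_int k + 1 + d < x" "x < min b (h + of_int k + 2 - d)"
      using dense[of "h + of_int k + 1 + d" "min b (h + of_int k + 2 - d)"] assms by auto
    with k show ?thesis by (intro exI[of _ x] exI[of _ "k + 1"]) auto
  qed
qed

lemma card_exchange:
  fixes n k w :: nat
  assumes "k \<in> {1..n - 1}" "n - 1 < w"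
  shows "card (({1..n - 1} - {k}) \<union> {w}) + 1 = n"
proof -
  have "w \<notin> {1..n - 1} - {k}" using assms by auto
  moreover have "card ({1..n - 1} - {k}) = n - 2" using assms by simp
  moreover have "2 \<le> n" using assms(1) by auto
  ultimately show ?thesis by (simp add: card_insert_if)
qed

lemma not_tight_exchange:
  fixes n k w :: nat
  assumes "k \<in> {1..n - 1}" "n - 1 < w" "0 \<le> t" "t < 1"
    and "\<And>v. v \<in> {1..n - 1} - {k} \<Longrightarrow> 1 / real n < dist_nearest_int (real v * t)"
    and "1 / real n < dist_nearest_int (real w * t)"
  shows "\<not> tight (({1..n - 1} - {k}) \<union> {w})"
proof -
  have "1 / real n < LR (({1..n - 1} - {k}) \<union> {w})"
    by (rule LR_gt[of _ t]) (use assms in auto)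
  then show ?thesis
    unfolding tight_def card_exchange[OF assms(1,2)] by simp
qed

subsection \<open>Times near one half\<close>

text \<open>Modulo 1, \<open>v * (1/2 - s)\<close> is \<open>- v * s\<close> for even
  \<open>v\<close> and \<open>1/2 - v * s\<close> for odd \<open>v\<close>. With 2 removed, even
  speeds are at least 4, hence the lower end \<open>1 / (4 * n)\<close>. The bound for odd speeds
  stays a hypothesis because the largest odd speed depends on the parity of
  \<open>n\<close>.\<close>

lemma dist_gt_near_half:
  fixes n v :: nat
  assumes n: "5 \<le> n" and s: "1 / (4 * real n) < s" "s < 1 / (2 * real n)"
    and odd: "odd v \<Longrightarrow> real v * s < 1/2 - 1 / real n"
    and v: "v \<in> {1..n - 1} - {2}"
  shows "1 / real n < dist_nearest_int (real v * (1/2 - s))"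
proof -
  define d where "d = 1 / real n"
  have d: "0 < d" "d \<le> 1/5" "real n * d = 1" using n by (auto simp: d_def field_simps)
  have s': "d / 4 < s" "s < d / 2" using s by (simp_all add: d_def)
  show ?thesis
  proof (cases "even v")
    case True
    then obtain j where j: "v = 2 * j" by blast
    with v have "4 \<le> real v" by simp
    then have "4 * s \<le> real v * s" using s' d by (intro mult_right_mono) auto
    then have lo: "d < real v * s" using s' by linarith
    have "real v * s \<le> real n * s" using v s' d by (intro mult_right_mono) auto
    also have "\<dots> < real n * (d / 2)" using s' n by simp
    also have "\<dots> = 1/2" using d by simp
    finally have hi: "real v * s < 1/2" .
    show ?thesis unfolding d_def[symmetric]
      by (rule dist_nearest_int_gtI[of "int j - 1"])
        (use lo hi d j in \<open>auto simp: algebra_simps\<close>)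
  next
    case False
    then obtain j where j: "v = 2 * j + 1" using oddE by blast
    have lo: "0 < real v * s" using v s' d by simp
    have hi: "real v * s < 1/2 - d" using odd False by (simp add: d_def)
    have "real v / 2 = real j + 1/2" using j by (simp add: field_simps)
    then have e: "real v * (1/2 - s) = real j + 1/2 - real v * s" by (simp add: algebra_simps)
    show ?thesis unfolding d_def[symmetric]
      by (rule dist_nearest_int_gtI[of "int j"])
        (use lo hi d e in auto)
  qed
qed

text \<open>For \<open>s\<close> in the window from \<open>1 / (4 * n)\<close> to \<open>c\<close>,
  \<open>w * s\<close> sweeps the interval from \<open>w / (4 * n)\<close> to \<open>w * c\<close>,
  and \<open>w * (1/2 - s)\<close> is \<open>h - w * s\<close> modulo 1. So \<open>far\<close> is
  what \<open>interval_contains_far_point\<close> asks of this interval.\<close>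

lemma not_tight_remove_2:
  fixes n w :: nat and c :: real
  assumes n: "5 \<le> n" and w: "n - 1 < w"
    and c: "1 / (4 * real n) < c" "c \<le> 1 / (2 * real n)"
    and odd: "\<And>v. odd v \<Longrightarrow> v < n \<Longrightarrow> real v * c \<le> 1/2 - 1 / real n"
    and h: "h = (if even w then 0 else 1/2)"
    and far: "2 / real n < real w * c - real w / (4 * real n) \<or>
      (\<exists>k::int. of_int k + 1 / real n \<le> real w / (4 * real n) - h \<and>
                real w / (4 * real n) - h < of_int k + 1 - 1 / real n)"
  shows "\<not> tight (({1..n - 1} - {2}) \<union> {w})"
proof -
  have w0: "0 < real w" using w by simp
  have "real w / (4 * real n) < real w * c"
    using mult_strict_left_mono[OF c(1) w0] by simp
  moreover have "1 / real n < 1/2" using n by (simp add: field_simps)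
  ultimately obtain x and k :: int where x: "real w / (4 * real n) < x" "x < real w * c"
      "of_int k + 1 / real n < x - h" "x - h < of_int k + 1 - 1 / real n"
    using interval_contains_far_point[of "real w / (4 * real n)" "real w * c" "1 / real n" h] far
    by auto
  define s where "s = x / real w"
  have ws: "real w * s = x" using w0 by (simp add: s_def)
  have s: "1 / (4 * real n) < s" "s < c"
    using x w0 by (auto simp: s_def field_simps)
  have s0: "0 < s" by (rule less_trans[OF _ s(1)]) (use n in simp)
  have "1 / (2 * real n) \<le> 1/10" using n by (simp add: field_simps)
  then have s1: "s < 1/2" using s c by linarith
  show ?thesis
  proof (rule not_tight_exchange[where t = "1/2 - s"])
    fix v assume v: "v \<in> {1..n - 1} - {2}"
    show "1 / real n < dist_nearest_int (real v * (1/2 - s))"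
    proof (rule dist_gt_near_half[OF n s(1) _ _ v])
      show "s < 1 / (2 * real n)" using s c by simp
      assume ov: "odd v"
      have "real v * s < real v * c" using v s by simp
      also have "\<dots> \<le> 1/2 - 1 / real n" using v by (intro odd ov) auto
      finally show "real v * s < 1/2 - 1 / real n" .
    qed
  next
    obtain j :: int where j: "real w / 2 = of_int j + h"
    proof (cases "even w")
      case True
      then obtain i where "w = 2 * i" by blast
      with True h show ?thesis by (intro that[of "int i"]) auto
    next
      case False
      then obtain i where "w = 2 * i + 1" using oddE by blast
      with False h show ?thesis by (intro that[of "int i"]) (auto simp: field_simps)
    qed
    then have "real w * (1/2 - s) = of_int j - (x - h)"
      using ws by (simp add: algebra_simps)
    \<comment> \<open>Reflection turns the unit interval starting at \<open>k\<close> into the one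
      starting at \<open>j - k - 1\<close>.\<close>
    then show "1 / real n < dist_nearest_int (real w * (1/2 - s))"
      by (intro dist_nearest_int_gtI[of "j - k - 1"]) (use x in auto)
  qed (use n w s0 s1 in auto)
qed

text \<open>For odd \<open>n\<close> the odd speeds are at most \<open>n - 2\<close>, so the window
  may extend to \<open>1 / (2 * n)\<close>. Stretched, it has length \<open>w / (4 * n)\<close>,
  which exceeds \<open>2 / n\<close> once \<open>w \<ge> 9\<close>.\<close>

lemma not_tight_remove_2_odd:
  assumes n: "5 \<le> n" and w: "n - 1 < w" "odd n" "(n, w) \<noteq> (5, 7)"
  shows "\<not> tight (({1..n - 1} - {2}) \<union> {w})"
proof (rule not_tight_remove_2[where c = "1 / (2 * real n)", OF n w(1) _ _ _ refl])
  show "1 / (4 * real n) < 1 / (2 * real n)" using n by (simp add: field_simps)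
  fix v assume "odd v" "v < n"
  then have "v + 2 \<le> n" using w(2) by (metis Suc_leI add_2_eq_Suc' dvd_diff_nat even_Suc le_neq_implies_less)
  then have "real v + 2 \<le> real n" by linarith
  then show "real v * (1 / (2 * real n)) \<le> 1/2 - 1 / real n" using n by (simp add: field_simps)
next
  have len: "2 / real n < real w * (1 / (2 * real n)) - real w / (4 * real n)" if "9 \<le> w"
    using that n by (simp add: field_simps)
  have "w \<in> {5, 6, 7, 8}" if "w < 9" using n w(1) that by auto
  moreover have "n \<in> {5, 7}" if "w < 9"
  proof -
    have "n < 9" using w(1) that by linarith
    then have "n \<in> {5, 6, 7, 8}" using n by auto
    with w(2) show ?thesis by auto
  qed
  \<comment> \<open>In the five small pairs the left end is good. For \<open>(5, 7)\<close> it is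
    \<open>-3/20\<close>, which is bad, and the length \<open>7/20\<close> is below
    \<open>2/5\<close>.\<close>
  ultimately consider "9 \<le> w" | "n = 5" "w = 5" | "n = 5" "w = 6" | "n = 5" "w = 8"
    | "n = 7" "w = 7" | "n = 7" "w = 8"
    using w by fastforce
  then show "2 / real n < real w * (1 / (2 * real n)) - real w / (4 * real n) \<or>
      (\<exists>k::int. of_int k + 1 / real n \<le> real w / (4 * real n) - (if even w then 0 else 1/2) \<and>
                real w / (4 * real n) - (if even w then 0 else 1/2) < of_int k + 1 - 1 / real n)"
    using len by cases (auto intro: exI[of _ "0::int"] exI[of _ "-1::int"])
qed simp

text \<open>For even \<open>n\<close> the speed \<open>n - 1\<close> is odd, so \<open>c\<close> is
  the solution of \<open>(n - 1) * c = 1/2 - 1 / n\<close>. The left end is good for even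
  \<open>w < 4 * n - 4\<close> and for odd \<open>w < 2 * n - 4\<close>; beyond that the stretched
  window is long enough, except for a few \<open>w\<close> when \<open>n = 6\<close>.\<close>

lemma not_tight_remove_2_even:
  assumes n: "5 \<le> n" and w: "n - 1 < w" "even n" "(n, w) \<noteq> (6, 9)"
  shows "\<not> tight (({1..n - 1} - {2}) \<union> {w})"
proof -
  have n6: "6 \<le> n" using n w(2) by presburger
  define c where "c = (real n - 2) / (2 * real n * (real n - 1))"
  have len: "real w * c - real w / (4 * real n) = real w * (real n - 3) / (4 * real n * (real n - 1))"
  proof -
    have "c - 1 / (4 * real n) = (real n - 3) / (4 * real n * (real n - 1))"
      unfolding c_def using n6 by (simp add: divide_simps) (simp add: algebra_simps)
    then show ?thesis by (metis right_diff_distrib times_divide_eq_right mult.right_neutral)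
  qed
  have long: "2 / real n < real w * c - real w / (4 * real n)"
    if "8 * (real n - 1) < real w * (real n - 3)"
    unfolding len using that n6 by (simp add: divide_simps)
  have general: ?thesis if far: "2 / real n < real w * c - real w / (4 * real n) \<or>
      (\<exists>k::int. of_int k + 1 / real n \<le> real w / (4 * real n) - (if even w then 0 else 1/2) \<and>
                real w / (4 * real n) - (if even w then 0 else 1/2) < of_int k + 1 - 1 / real n)"
  proof (rule not_tight_remove_2[OF n w(1) _ _ _ refl far])
    show "1 / (4 * real n) < c" "c \<le> 1 / (2 * real n)"
      unfolding c_def using n6 by (simp_all add: divide_simps)
    fix v assume "v < n"
    then have "real v * c \<le> (real n - 1) * c"
      using n6 by (intro mult_right_mono) (auto simp: c_def)
    also have "\<dots> = 1/2 - 1 / real n"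
      unfolding c_def using n6 by (simp add: divide_simps)
    finally show "real v * c \<le> 1/2 - 1 / real n" .
  qed
  show ?thesis
  proof (cases "even w")
    case True
    show ?thesis
    proof (cases "w + 4 < 4 * n")
      case True
      have "1 / real n \<le> real w / (4 * real n)" "real w / (4 * real n) < 1 - 1 / real n"
        using True n6 w(1) by (simp_all add: field_simps)
      then show ?thesis
        using \<open>even w\<close> by (intro general disjI2 exI[of _ 0]) auto
    next
      case False
      then have "4 * (real n - 1) \<le> real w" by simp
      then have "4 * (real n - 1) * (real n - 3) \<le> real w * (real n - 3)"
        using n6 by (intro mult_right_mono) auto
      moreover have "4 * (real n - 1) * 2 < 4 * (real n - 1) * (real n - 3)"
        using n6 by (intro mult_strict_left_mono) auto
      ultimately show ?thesis by (intro general disjI1 long) simp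
    qed
  next
    case ow: False
    show ?thesis
    proof (cases "w + 4 < 2 * n")
      case True
      have "real w + 4 < 2 * real n" using True by linarith
      then have "(real w + 4) / (4 * real n) < 1/2" using n6 by (simp add: field_simps)
      moreover have "real w / (4 * real n) + 1 / real n = (real w + 4) / (4 * real n)"
        using n6 by (simp add: field_simps)
      moreover have "0 \<le> real w / (4 * real n)" "1 / real n \<le> 1/2" using n6 by auto
      ultimately have "1 / real n - 1 \<le> real w / (4 * real n) - 1/2"
        "real w / (4 * real n) - 1/2 < - (1 / real n)" by linarith+
      then show ?thesis
        using ow by (intro general disjI2 exI[of _ "-1"]) auto
    next
      case False
      with ow have "2 * n \<le> w + 3" by presburger
      then have w2: "2 * real n - 3 \<le> real w" by linarith
      show ?thesis
      proof (cases "n = 6")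
        case False
        with n6 w(2) have "8 \<le> n" by presburger
        then have n8: "8 \<le> real n" by linarith
        then have "8 * (real n - 1) < (2 * real n - 3) * 5" by simp
        also have "\<dots> \<le> (2 * real n - 3) * (real n - 3)"
          using n8 by (intro mult_left_mono) auto
        also have "\<dots> \<le> real w * (real n - 3)"
          using w2 n8 by (intro mult_right_mono) auto
        finally show ?thesis by (intro general disjI1 long)
      next
        case True
        with w2 have "9 \<le> w" by linarith
        moreover have "w \<noteq> 9" using w(3) True by simp
        \<comment> \<open>For \<open>n = 6\<close> the length test needs \<open>w \<ge> 14\<close>.
          For 11 and 13 the left end is bad, but the stretched window still leaves the gap on the
          right: the times \<open>1/2 - 7/110\<close> and \<open>1/2 - 1/16\<close> used below come
          from the window \<open>1/24 < s < 1/15\<close>.\<close>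
        ultimately have "w = 11 \<or> w = 13 \<or> 14 \<le> w" using ow by presburger
        moreover have set6: "{1..6 - 1::nat} - {2} = {1, 3, 4, 5}" by auto
        have ?thesis if "w = 11"
          unfolding that True
        proof (rule not_tight_exchange[where t = "24/55"])
          fix v :: nat assume "v \<in> {1..6 - 1} - {2}"
          then have "v = 1 \<or> v = 3 \<or> v = 4 \<or> v = 5" unfolding set6 by blast
          \<comment> \<open>Both times are close to \<open>3/7\<close>, so
            \<open>3 * v div 7\<close> is the integer part of \<open>v * t\<close> for these four
            speeds.\<close>
          then show "1 / real 6 < dist_nearest_int (real v * (24/55))"
            by (intro dist_nearest_int_gtI[of "int (3 * v div 7)"]) auto
        next
          show "1 / real 6 < dist_nearest_int (real 11 * (24/55))"
            by (rule dist_nearest_int_gtI[of 4]) auto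
        qed auto
        moreover have ?thesis if "w = 13"
          unfolding that True
        proof (rule not_tight_exchange[where t = "7/16"])
          fix v :: nat assume "v \<in> {1..6 - 1} - {2}"
          then have "v = 1 \<or> v = 3 \<or> v = 4 \<or> v = 5" unfolding set6 by blast
          then show "1 / real 6 < dist_nearest_int (real v * (7/16))"
            by (intro dist_nearest_int_gtI[of "int (3 * v div 7)"]) auto
        next
          show "1 / real 6 < dist_nearest_int (real 13 * (7/16))"
            by (rule dist_nearest_int_gtI[of 5]) auto
        qed auto
        moreover have ?thesis if "14 \<le> w"
          using that True by (intro general disjI1 long) simp
        ultimately show ?thesis by blast
      qed
    qed
  qed
qed

section \<open>The two exceptional tight sets\<close>

lemma tight_1_3_4_7: "tight {1, 3, 4, 7}"
proof -
  \<comment> \<open>No element is divisible by 5, so every distance at time \<open>1/5\<close> is at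
    least \<open>1/5\<close>.\<close>
  have "LR {1, 3, 4, 7} = 1/5"
  proof (rule LR_eqI[where t = "1/5"])
    fix v :: nat assume "v \<in> {1, 3, 4, 7}"
    then show "1/5 \<le> dist_nearest_int (real v * (1/5))"
      by (auto simp: dist_nearest_int_def round_def)
  next
    fix s :: real assume s: "0 \<le> s" "s < 1"
    show "\<exists>v\<in>{1, 3, 4, 7}. dist_nearest_int (real v * s) \<le> 1/5"
    proof (rule ccontr)
      assume "\<not> ?thesis"
      then have "1/5 < dist_nearest_int s" "1/5 < dist_nearest_int (3 * s)"
        "1/5 < dist_nearest_int (4 * s)" "1/5 < dist_nearest_int (7 * s)" by auto
      then obtain a b c d :: int where
        a: "of_int a + 1/5 < s" "s < of_int a + 1 - 1/5" and
        b: "of_int b + 1/5 < 3 * s" "3 * s < of_int b + 1 - 1/5" and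
        c: "of_int c + 1/5 < 4 * s" "4 * s < of_int c + 1 - 1/5" and
        d: "of_int d + 1/5 < 7 * s" "7 * s < of_int d + 1 - 1/5"
        by (meson dist_nearest_int_gtD)
      have "a = 0" using a s by linarith
      with a have s': "1/5 < s" "s < 4/5" by simp_all
      \<comment> \<open>The integer parts take finitely many values, and each combination gives an
        infeasible linear system in \<open>s\<close>.\<close>
      have "b = 0 \<or> b = 1 \<or> b = 2" using b s' by linarith
      moreover have "c = 0 \<or> c = 1 \<or> c = 2 \<or> c = 3" using c s' by linarith
      moreover have "d = 1 \<or> d = 2 \<or> d = 3 \<or> d = 4 \<or> d = 5" using d s' by linarith
      ultimately show False
        using s' b c d by (elim disjE) simp_all
    qed
  qed auto
  then show ?thesis by (simp add: tight_def)
qed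

lemma tight_1_3_4_5_9: "tight {1, 3, 4, 5, 9}"
proof -
  have "LR {1, 3, 4, 5, 9} = 1/6"
  proof (rule LR_eqI[where t = "1/6"])
    fix v :: nat assume "v \<in> {1, 3, 4, 5, 9}"
    then show "1/6 \<le> dist_nearest_int (real v * (1/6))"
      by (auto simp: dist_nearest_int_def round_def)
  next
    fix s :: real assume s: "0 \<le> s" "s < 1"
    show "\<exists>v\<in>{1, 3, 4, 5, 9}. dist_nearest_int (real v * s) \<le> 1/6"
    proof (rule ccontr)
      assume "\<not> ?thesis"
      then have "1/6 < dist_nearest_int s" "1/6 < dist_nearest_int (3 * s)"
        "1/6 < dist_nearest_int (4 * s)" "1/6 < dist_nearest_int (5 * s)"
        "1/6 < dist_nearest_int (9 * s)" by auto
      then obtain a b c d e :: int where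
        a: "of_int a + 1/6 < s" "s < of_int a + 1 - 1/6" and
        b: "of_int b + 1/6 < 3 * s" "3 * s < of_int b + 1 - 1/6" and
        c: "of_int c + 1/6 < 4 * s" "4 * s < of_int c + 1 - 1/6" and
        d: "of_int d + 1/6 < 5 * s" "5 * s < of_int d + 1 - 1/6" and
        e: "of_int e + 1/6 < 9 * s" "9 * s < of_int e + 1 - 1/6"
        by (meson dist_nearest_int_gtD)
      have "a = 0" using a s by linarith
      with a have s': "1/6 < s" "s < 5/6" by simp_all
      have "b = 0 \<or> b = 1 \<or> b = 2" using b s' by linarith
      moreover have "c = 0 \<or> c = 1 \<or> c = 2 \<or> c = 3" using c s' by linarith
      moreover have "d = 0 \<or> d = 1 \<or> d = 2 \<or> d = 3 \<or> d = 4" using d s' by linarith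
      \<comment> \<open>Speeds 1, 3, 4, 5 leave only times at distance between \<open>1/24\<close>
        and \<open>1/15\<close> from \<open>1/2\<close>. There \<open>9 * s\<close> stays within
        \<open>1/8\<close> of 4 or 5.\<close>
      ultimately have "13/30 < s \<and> s < 11/24 \<or> 13/24 < s \<and> s < 17/30"
        using s' b c d by (elim disjE) simp_all
      moreover from this have "e = 3 \<or> e = 4 \<or> e = 5" using e by linarith
      ultimately show False
        using e by (elim disjE) simp_all
    qed
  qed auto
  then show ?thesis by (simp add: tight_def)
qed

subsection \<open>Times near one third\<close>

lemma mod_3_cases:
  fixes v :: nat
  obtains j where "v = 3 * j" | j where "v = 3 * j + 1" | j where "v = 3 * j + 2"
  by atomize_elim presburger

text \<open>Modulo 1, \<open>v * (1/3 + s)\<close> is \<open>v * s\<close> plus 0,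
  \<open>1/3\<close> or \<open>2/3\<close>. With 3 removed, multiples of 3 are at least 6, hence the
  lower end \<open>1 / (6 * n)\<close>; the other residues tolerate a shift below
  \<open>1/3 - 1 / n\<close> in either direction.\<close>

lemma dist_gt_near_third:
  fixes n v :: nat
  assumes n: "7 \<le> n" and s: "1 / (6 * real n) < \<bar>s\<bar>" "(real n - 1) * \<bar>s\<bar> < 1/3 - 1 / real n"
    and v: "v \<in> {1..n - 1} - {3}"
  shows "1 / real n < dist_nearest_int (real v * (1/3 + s))"
proof -
  define d where "d = 1 / real n"
  have d: "0 < d" "d \<le> 1/7" using n by (auto simp: d_def field_simps)
  have s': "d / 6 < \<bar>s\<bar>" using s by (simp add: d_def)
  have vs: "\<bar>real v * s\<bar> = real v * \<bar>s\<bar>" by (simp add: abs_mult)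
  have "real v * \<bar>s\<bar> \<le> (real n - 1) * \<bar>s\<bar>" using v by (intro mult_right_mono) auto
  then have hi: "\<bar>real v * s\<bar> < 1/3 - d" using s unfolding vs d_def by linarith
  show ?thesis
  proof (cases v rule: mod_3_cases)
    case (1 j)
    with v have "6 \<le> real v" by simp
    then have "6 * \<bar>s\<bar> \<le> real v * \<bar>s\<bar>" by (intro mult_right_mono) auto
    then have lo: "d < \<bar>real v * s\<bar>" using s' vs by simp
    have e: "real v * (1/3 + s) = real j + real v * s" using 1 by (simp add: algebra_simps)
    show ?thesis
    proof (cases "0 \<le> real v * s")
      case True
      show ?thesis unfolding d_def[symmetric]
        by (rule dist_nearest_int_gtI[of "int j"]) (use True lo hi d e in auto)
    next
      case False
      show ?thesis unfolding d_def[symmetric]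
        by (rule dist_nearest_int_gtI[of "int j - 1"]) (use False lo hi d e in auto)
    qed
  next
    case (2 j)
    then have e: "real v * (1/3 + s) = real j + 1/3 + real v * s" by (simp add: field_simps)
    show ?thesis unfolding d_def[symmetric]
      by (rule dist_nearest_int_gtI[of "int j"]) (use hi d e in auto)
  next
    case (3 j)
    then have e: "real v * (1/3 + s) = real j + 2/3 + real v * s" by (simp add: field_simps)
    show ?thesis unfolding d_def[symmetric]
      by (rule dist_nearest_int_gtI[of "int j"]) (use hi d e in auto)
  qed
qed

text \<open>Adding the two arguments cancels \<open>x\<close>: \<open>2 * w / 3\<close> is within
  \<open>2 * d < 1/3\<close> of the integer \<open>m\<close>, so the integer
  \<open>2 * w - 3 * m\<close> vanishes.\<close>

lemma dvd_3_if_near_thirds: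
  fixes w :: nat
  assumes "d < 1/6" "dist_nearest_int (real w / 3 + x) \<le> d" "dist_nearest_int (real w / 3 - x) \<le> d"
  shows "3 dvd w"
proof -
  define m where "m = round (real w / 3 + x) + round (real w / 3 - x)"
  have "\<bar>real w / 3 + x - of_int (round (real w / 3 + x))\<bar> \<le> d"
    "\<bar>real w / 3 - x - of_int (round (real w / 3 - x))\<bar> \<le> d"
    using assms by (simp_all add: dist_nearest_int_def)
  with assms(1) have "\<bar>2 * real w - 3 * of_int m\<bar> < 1"
    unfolding m_def of_int_add by (auto simp: abs_le_iff abs_less_iff)
  then have "\<bar>of_int (2 * int w - 3 * m) :: real\<bar> < 1" by simp
  then have "2 * int w = 3 * m" by linarith
  then show ?thesis by presburger
qed

text \<open>Here \<open>c\<close> solves \<open>(n - 1) * c = 1/3 - 1 / n\<close>. If 3 does not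
  divide \<open>w\<close>, any \<open>s\<close> in the window works with one of the two signs;
  otherwise \<open>w / 3\<close> is an integer and the interval argument applies with shift
  0.\<close>

lemma not_tight_remove_3_large:
  fixes n w :: nat
  assumes n: "7 \<le> n" and w: "n - 1 < w"
  shows "\<not> tight (({1..n - 1} - {3}) \<union> {w})"
proof -
  define c where "c = (real n - 3) / (3 * real n * (real n - 1))"
  have d: "1 / real n \<le> 1/7" using n by (simp add: field_simps)
  have cn: "(real n - 1) * c = 1/3 - 1 / real n"
    unfolding c_def using n by (simp add: divide_simps)
  have c: "1 / (6 * real n) < c" unfolding c_def using n by (simp add: divide_simps)
  have c0: "0 < c" unfolding c_def using n by simp
  have "6 * c \<le> (real n - 1) * c" using n c0 by (intro mult_right_mono) auto
  also have "\<dots> < 1/3" using cn n by simp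
  finally have c1: "c < 1/3" by simp
  have general: ?thesis
    if s: "1 / (6 * real n) < \<bar>s\<bar>" "\<bar>s\<bar> < c" and far: "1 / real n < dist_nearest_int (real w * (1/3 + s))"
    for s
  proof (rule not_tight_exchange[OF _ w _ _ _ far])
    fix v assume v: "v \<in> {1..n - 1} - {3}"
    have "(real n - 1) * \<bar>s\<bar> < (real n - 1) * c"
      using s n by (intro mult_strict_left_mono) auto
    then show "1 / real n < dist_nearest_int (real v * (1/3 + s))"
      using dist_gt_near_third[OF n s(1) _ v] cn by simp
  qed (use n s c1 in auto)
  show ?thesis
  proof (cases "3 dvd w")
    case False
    obtain s where s: "1 / (6 * real n) < s" "s < c" using dense[OF c] by blast
    moreover have "0 < s" by (rule less_trans[OF _ s(1)]) (use n in simp)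
    moreover have "1 / real n < dist_nearest_int (real w * (1/3 + s))
      \<or> 1 / real n < dist_nearest_int (real w * (1/3 + - s))"
    proof (rule ccontr)
      assume "\<not> ?thesis"
      moreover have "real w * (1/3 + s) = real w / 3 + real w * s"
        "real w * (1/3 + - s) = real w / 3 - real w * s" by (simp_all add: algebra_simps)
      moreover have "1 / real n < 1/6" using d by linarith
      ultimately show False
        using dvd_3_if_near_thirds[of "1 / real n" w "real w * s"] False by (simp add: not_less)
    qed
    ultimately show ?thesis using general[of s] general[of "- s"] by auto
  next
    case True
    then obtain j where j: "w = 3 * j" by blast
    \<comment> \<open>For \<open>(7, 36)\<close> the stretched window from \<open>6/7\<close> to
      \<open>8/7\<close> just fills the bad gap around 1. The time \<open>7/24 = 1/3 - 1/24\<close>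
      lies outside the window \<open>\<bar>s\<bar> < c\<close>, yet works: the closest speed is 4,
      at distance \<open>1/6\<close>.\<close>
    show ?thesis
    proof (cases "n = 7 \<and> w = 36")
      case True
      have "\<not> tight (({1..7 - 1} - {3}) \<union> {36})"
      proof (rule not_tight_exchange[where t = "7/24"])
        fix v :: nat assume "v \<in> {1..7 - 1} - {3}"
        then have "v = 1 \<or> v = 2 \<or> v = 4 \<or> v = 5 \<or> v = 6" by auto
        then show "1 / real 7 < dist_nearest_int (real v * (7/24))"
          by (intro dist_nearest_int_gtI[of "int (v div 4)"]) auto
      next
        show "1 / real 7 < dist_nearest_int (real 36 * (7/24))"
          by (rule dist_nearest_int_gtI[of 10]) auto
      qed auto
      with True show ?thesis by simp
    next
      case False
      have w0: "0 < real w" using w by simp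
      have "real w / (6 * real n) < real w * c"
        using mult_strict_left_mono[OF c w0] by simp
      moreover have "1 / real n < 1/2" using d by simp
      moreover have "2 * (1 / real n) < real w * c - real w / (6 * real n) \<or>
          (\<exists>k::int. of_int k + 1 / real n \<le> real w / (6 * real n) - 0 \<and>
                    real w / (6 * real n) - 0 < of_int k + 1 - 1 / real n)"
      proof (cases "w + 6 < 6 * n")
        case True
        then have "1 / real n \<le> real w / (6 * real n)" "real w / (6 * real n) < 1 - 1 / real n"
          using n w by (simp_all add: field_simps)
        then show ?thesis by (intro disjI2 exI[of _ 0]) simp
      next
        case w6: False
        \<comment> \<open>Now \<open>w \<ge> 6 * (n - 1)\<close>, so \<open>n - 5 > 2\<close>
          suffices; for \<open>n = 7\<close> the claim is \<open>w > 36\<close>, with 36 already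
          excluded.\<close>
        have "12 * (real n - 1) < real w * (real n - 5)"
        proof (cases "n = 7")
          case True
          with w6 False show ?thesis by simp
        next
          case False
          have "6 * (real n - 1) * 2 < 6 * (real n - 1) * (real n - 5)"
            using n False by (intro mult_strict_left_mono) auto
          then have "12 * (real n - 1) < 6 * (real n - 1) * (real n - 5)" by linarith
          also have "\<dots> \<le> real w * (real n - 5)"
            using w6 n by (intro mult_right_mono) auto
          finally show ?thesis .
        qed
        moreover have "c - 1 / (6 * real n) = (real n - 5) / (6 * real n * (real n - 1))"
          unfolding c_def using n by (simp add: divide_simps) (simp add: algebra_simps)
        then have "real w * c - real w / (6 * real n) = real w * (real n - 5) / (6 * real n * (real n - 1))"
          by (metis right_diff_distrib times_divide_eq_right mult.right_neutral)
        moreover have "2 * (1 / real n) < real w * (real n - 5) / (6 * real n * (real n - 1))"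
          if "12 * (real n - 1) < real w * (real n - 5)"
          using that n by (simp add: divide_simps)
        ultimately show ?thesis by simp
      qed
      ultimately obtain x and k :: int where x: "real w / (6 * real n) < x" "x < real w * c"
          "of_int k + 1 / real n < x - 0" "x - 0 < of_int k + 1 - 1 / real n"
        using interval_contains_far_point[of "real w / (6 * real n)" "real w * c" "1 / real n" 0]
        by auto
      define s where "s = x / real w"
      have ws: "real w * s = x" using w0 by (simp add: s_def)
      have s: "1 / (6 * real n) < s" "s < c"
        using x w0 by (auto simp: s_def field_simps)
      have "0 < s" by (rule less_trans[OF _ s(1)]) (use n in simp)
      moreover have "real w * (1/3 + s) = real j + x"
        using ws j by (simp add: algebra_simps)
      then have "1 / real n < dist_nearest_int (real w * (1/3 + s))"
        by (intro dist_nearest_int_gtI[of "int j + k"]) (use x in auto)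
      ultimately show ?thesis using general[of s] s by simp
    qed
  qed
qed

text \<open>For these \<open>n\<close> no multiple of 3 remains among the old speeds, so time
  \<open>1/3\<close> works unless 3 divides \<open>w\<close>; then the perturbation
  \<open>x / w\<close> gives \<open>w * t\<close> the fractional part \<open>x\<close>.\<close>

lemma not_tight_remove_3_small:
  fixes n w :: nat
  assumes n: "n = 5 \<or> n = 6" and w: "n - 1 < w"
  shows "\<not> tight (({1..n - 1} - {3}) \<union> {w})"
proof -
  \<comment> \<open>Besides \<open>x > 1 / n\<close>, the bound \<open>r \<le> x / 6\<close> must
    keep the old speeds good: speed 2 requires \<open>x < 2/5\<close> for \<open>n = 5\<close>, and
    speed 5 requires \<open>x < 1/5\<close> for \<open>n = 6\<close>, where \<open>11/60\<close> is
    midway between \<open>1/6\<close> and \<open>1/5\<close>.\<close>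
  define x where "x = (if n = 5 then 1/4 else 11/60 :: real)"
  have x: "1 / real n < x" "x < 1 - 1 / real n" using n by (auto simp: x_def)
  define r where "r = (if 3 dvd w then x / real w else 0)"
  have "6 \<le> w" if "3 dvd w" using n w that by presburger
  moreover have "0 < x" by (simp add: x_def)
  ultimately have r: "0 \<le> r" "r \<le> x / 6"
    using frac_le[of x x 6 "real w"] by (auto simp: r_def)
  show ?thesis
  proof (rule not_tight_exchange[OF _ w, where t = "1/3 + r"])
    fix v assume "v \<in> {1..n - 1} - {3}"
    then have "v = 1 \<or> v = 2 \<or> v = 4 \<or> v = 5 \<and> n = 6" using n by auto
    then show "1 / real n < dist_nearest_int (real v * (1/3 + r))"
      using n r by (intro dist_nearest_int_gtI[of "int (v div 3)"]) (auto simp: x_def)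
  next
    show "1 / real n < dist_nearest_int (real w * (1/3 + r))"
    proof (cases w rule: mod_3_cases)
      case (1 j)
      then have "real w * (1/3 + r) = real j + x" using w by (simp add: r_def field_simps)
      then show ?thesis using x by (intro dist_nearest_int_gtI[of "int j"]) auto
    next
      case (2 j)
      then have "\<not> 3 dvd w" by presburger
      with 2 have "real w * (1/3 + r) = real j + 1/3" by (simp add: r_def field_simps)
      then show ?thesis using n by (intro dist_nearest_int_gtI[of "int j"]) auto
    next
      case (3 j)
      then have "\<not> 3 dvd w" by presburger
      with 3 have "real w * (1/3 + r) = real j + 2/3" by (simp add: r_def field_simps)
      then show ?thesis using n by (intro dist_nearest_int_gtI[of "int j"]) auto
    qed
  qed (use n r in \<open>auto simp: x_def\<close>)
qed

theorem theorem1p7: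
  fixes n w :: nat
  assumes "n \<ge> 5" and "w > n - 1"
  shows "(tight (({1..n - 1} - {2}) \<union> {w}) \<longleftrightarrow> (n, w) \<in> {(5, 7), (6, 9)})
    \<and> \<not> tight (({1..n - 1} - {3}) \<union> {w})"
proof
  have "({1..5 - 1} - {2}) \<union> {7} = {1, 3, 4, 7::nat}"
    "({1..6 - 1} - {2}) \<union> {9} = {1, 3, 4, 5, 9::nat}" by auto
  then have "tight (({1..n - 1} - {2}) \<union> {w})" if "(n, w) \<in> {(5, 7), (6, 9)}"
    using that tight_1_3_4_7 tight_1_3_4_5_9 by auto
  then show "tight (({1..n - 1} - {2}) \<union> {w}) \<longleftrightarrow> (n, w) \<in> {(5, 7), (6, 9)}"
    using not_tight_remove_2_odd[OF assms] not_tight_remove_2_even[OF assms] by blast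
  show "\<not> tight (({1..n - 1} - {3}) \<union> {w})"
  proof (cases "7 \<le> n")
    case True
    then show ?thesis using not_tight_remove_3_large assms by blast
  next
    case False
    with assms have "n = 5 \<or> n = 6" by auto
    then show ?thesis using not_tight_remove_3_small assms by auto
  qed
qed

end
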